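(* Let $j\ge1$ be a fixed integer. For $n\in\mathbb{N}$, let $\alpha$ be sampled uniformly at random from the set of all weakly increasing parking functions of length $n$, and let $X$ be a Poisson random variable with mean $\lambda=n+j-2$, i.e. $\Pr[X=k]=\lambda^k e^{-\lambda}/k!$. Then, as $n\to\infty$, $$\Pr[\alpha_n=j]\sim\frac{\sqrt{\pi n}\,(n-j+1)\,e^{n+j-2}}{4^n}\,\Pr[X=j-1].$$
   Context: A weakly increasing parking function of length $n$ is a list $\alpha=(\alpha_1,\dots,\alpha_n)\in\{1,\dots,n\}^n$ with $\alpha_i\le i$ for all $i$ and $\alpha_1\le\alpha_2\le\cdots\le\alpha_n$. $a_n\sim b_n$ means $a_n/b_n\to1$ as $n\to\infty$. *)

theory Defs
  imports "HOL-Probability.Probability" "HOL-Library.Landau_Symbols"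
begin

(* Lists are indexed from 0, so the entry alpha_i of the usual notation is \<alpha> ! (i - 1). *)
definition weakly_increasing_parking_functions :: "nat \<Rightarrow> nat list set" where
  "weakly_increasing_parking_functions n =
     {\<alpha>. length \<alpha> = n \<and> set \<alpha> \<subseteq> {1..n} \<and> (\<forall>i\<in>{1..n}. \<alpha> ! (i - 1) \<le> i) \<and> sorted \<alpha>}"

(* pmf_of_set is the uniform distribution only on finite nonempty sets. *)
lemma finite_weakly_increasing_parking_functions:
  "finite (weakly_increasing_parking_functions n)"
  by (rule finite_subset[OF _ finite_lists_length_eq[of "{1..n}" n]])
     (auto simp: weakly_increasing_parking_functions_def)

lemma weakly_increasing_parking_functions_nonempty:
  "weakly_increasing_parking_functions n \<noteq> {}"
proof -
  have "replicate n 1 \<in> weakly_increasing_parking_functions n"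
    by (auto simp: weakly_increasing_parking_functions_def)
  then show ?thesis by blast
qed

end

theory Submission
  imports Defs "HOL-Real_Asymp.Real_Asymp"
begin

text \<open>
  The probability is a quotient of two ballot numbers, and both are known in closed form.

  Removing the last entry \<open>j\<close> of a weakly increasing parking function of length \<open>n\<close> leaves a weakly
  increasing parking function of length \<open>n - 1\<close> all of whose entries are at most \<open>j\<close>.  The numbers
  \<open>W n k\<close> of weakly increasing parking functions of length \<open>n\<close> with entries at most \<open>k\<close> therefore
  satisfy the Pascal-like recurrence \<open>W (n + 1) (k + 1) = W (n + 1) k + W n (k + 1)\<close> for \<open>k \<le> n\<close>
  (\<open>card_bounded_wipf_Suc\<close>), which the ballot numbers
  \<open>W n (k + 1) = (n + 1 - k) / (n + 1) * ((n + k) choose k)\<close> solve (\<open>card_bounded_wipf\<close>).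
  The case \<open>k = n\<close> is the Catalan number, which counts all weakly increasing parking functions.

  With \<open>k = j - 1\<close>, the probability is thus
  \<open>(n - k) (n + 1) / n * pochhammer n k / k! / ((2 n) choose n)\<close>.  On the other side, the
  factor \<open>exp (n + j - 2)\<close> cancels the exponential in the Poisson weight, and what remains is
  \<open>sqrt (\<pi> n) (n - k) / 4 ^ n * (n + k - 1) ^ k / k!\<close>.  The two agree asymptotically because
  the \<open>k\<close> factors of \<open>pochhammer n k\<close> are all asymptotic to \<open>n + k - 1\<close>, for fixed \<open>k\<close>, and because
  \<open>(2 n) choose n\<close> is asymptotic to \<open>4 ^ n / sqrt (\<pi> n)\<close> (\<open>central_binomial_limit\<close>).
\<close>


section \<open>Counting weakly increasing parking functions\<close>

definition bounded_wipf :: "nat \<Rightarrow> nat \<Rightarrow> nat list set" where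
  "bounded_wipf n k = {\<alpha> \<in> weakly_increasing_parking_functions n. set \<alpha> \<subseteq> {..k}}"

lemma finite_bounded_wipf [simp]: "finite (bounded_wipf n k)"
  by (simp add: bounded_wipf_def finite_weakly_increasing_parking_functions)

lemma wipf_iff:
  "\<alpha> \<in> weakly_increasing_parking_functions n \<longleftrightarrow>
     length \<alpha> = n \<and> (\<forall>i<n. 1 \<le> \<alpha> ! i \<and> \<alpha> ! i \<le> Suc i) \<and> sorted \<alpha>"
proof (cases "length \<alpha> = n")
  case True
  have "{1..n} = Suc ` {..<n}"
    by (simp add: lessThan_atLeast0 atLeastLessThanSuc_atLeastAtMost)
  then have upper: "(\<forall>i\<in>{1..n}. \<alpha> ! (i - 1) \<le> i) \<longleftrightarrow> (\<forall>i<n. \<alpha> ! i \<le> Suc i)"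
    by auto
  have range_iff: "set \<alpha> \<subseteq> {1..n} \<longleftrightarrow> (\<forall>i<n. 1 \<le> \<alpha> ! i \<and> \<alpha> ! i \<le> n)"
    unfolding subset_eq all_set_conv_all_nth using True by simp
  have "\<alpha> ! i \<le> n" if "\<forall>i<n. \<alpha> ! i \<le> Suc i" "i < n" for i
    using that(1)[rule_format, OF that(2)] that(2) by simp
  with True show ?thesis
    unfolding weakly_increasing_parking_functions_def mem_Collect_eq upper range_iff by blast
next
  case False
  then show ?thesis by (simp add: weakly_increasing_parking_functions_def)
qed

text \<open>
  The last entry dominates all others, so the only link between it and the rest of the list is
  that it bounds the rest.
\<close>
lemma wipf_snoc_iff:
  "\<beta> @ [x] \<in> weakly_increasing_parking_functions (Suc n) \<longleftrightarrow>
     \<beta> \<in> bounded_wipf n x \<and> 1 \<le> x \<and> x \<le> Suc n"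
proof (cases "length \<beta> = n")
  case True
  have init: "(\<forall>i<n. 1 \<le> (\<beta> @ [x]) ! i \<and> (\<beta> @ [x]) ! i \<le> Suc i) \<longleftrightarrow> (\<forall>i<n. 1 \<le> \<beta> ! i \<and> \<beta> ! i \<le> Suc i)"
    using True by (simp add: nth_append)
  have last: "(\<beta> @ [x]) ! n = x"
    using True by (simp add: nth_append)
  have sorted: "sorted (\<beta> @ [x]) \<longleftrightarrow> sorted \<beta> \<and> set \<beta> \<subseteq> {..x}"
    by (auto simp: sorted_append)
  show ?thesis
    using True unfolding wipf_iff bounded_wipf_def mem_Collect_eq All_less_Suc init last sorted
    by simp blast
next
  case False
  then show ?thesis by (simp add: wipf_iff bounded_wipf_def)
qed

lemma wipf_last_eq:
  assumes "1 \<le> x" "x \<le> Suc n"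
  shows "weakly_increasing_parking_functions (Suc n) \<inter> {\<alpha>. \<alpha> ! n = x}
           = (\<lambda>\<beta>. \<beta> @ [x]) ` bounded_wipf n x"
proof (intro equalityI subsetI)
  fix \<alpha> assume \<alpha>: "\<alpha> \<in> weakly_increasing_parking_functions (Suc n) \<inter> {\<alpha>. \<alpha> ! n = x}"
  then have len: "length \<alpha> = Suc n" by (simp add: wipf_iff)
  then obtain \<beta> y where \<beta>: "\<alpha> = \<beta> @ [y]" by (cases \<alpha> rule: rev_cases) auto
  with len have "length \<beta> = n" by simp
  with \<alpha> \<beta> have "y = x" by (simp add: nth_append)
  with \<alpha> \<beta> show "\<alpha> \<in> (\<lambda>\<beta>. \<beta> @ [x]) ` bounded_wipf n x"
    by (auto simp: wipf_snoc_iff)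
next
  fix \<alpha> assume "\<alpha> \<in> (\<lambda>\<beta>. \<beta> @ [x]) ` bounded_wipf n x"
  then obtain \<beta> where \<beta>: "\<alpha> = \<beta> @ [x]" "\<beta> \<in> bounded_wipf n x" by auto
  then have "length \<beta> = n" by (simp add: bounded_wipf_def wipf_iff)
  with \<beta> assms show "\<alpha> \<in> weakly_increasing_parking_functions (Suc n) \<inter> {\<alpha>. \<alpha> ! n = x}"
    by (auto simp: wipf_snoc_iff)
qed

lemma card_wipf_last_eq:
  assumes "1 \<le> x" "x \<le> Suc n"
  shows "card (weakly_increasing_parking_functions (Suc n) \<inter> {\<alpha>. \<alpha> ! n = x})
           = card (bounded_wipf n x)"
  unfolding wipf_last_eq[OF assms] by (rule card_image) (auto simp: inj_on_def)

lemma wipf_eq_bounded_wipf: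
  assumes "n \<le> k"
  shows "weakly_increasing_parking_functions n = bounded_wipf n k"
  using assms by (auto simp: bounded_wipf_def weakly_increasing_parking_functions_def)

lemma bounded_wipf_0_left: "bounded_wipf 0 k = {[]}"
  by (auto simp: bounded_wipf_def wipf_iff)

lemma bounded_wipf_0_right: "bounded_wipf (Suc n) 0 = {}"
proof -
  have "\<alpha> \<notin> bounded_wipf (Suc n) 0" for \<alpha>
  proof
    assume "\<alpha> \<in> bounded_wipf (Suc n) 0"
    then have "length \<alpha> = Suc n" "1 \<le> \<alpha> ! 0" "set \<alpha> \<subseteq> {0}"
      by (simp_all add: bounded_wipf_def wipf_iff)
    moreover from this have "\<alpha> ! 0 \<in> {0}" by (intro subsetD[OF _ nth_mem]) simp_all
    ultimately show False by simp
  qed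
  then show ?thesis by blast
qed

text \<open>The recurrence separates the lists whose largest, that is last, entry attains the bound.\<close>
lemma card_bounded_wipf_Suc:
  assumes "k \<le> n"
  shows "card (bounded_wipf (Suc n) (Suc k)) = card (bounded_wipf (Suc n) k) + card (bounded_wipf n (Suc k))"
proof -
  let ?L = "weakly_increasing_parking_functions (Suc n) \<inter> {\<alpha>. \<alpha> ! n = Suc k}"
  have bounded_iff: "\<alpha> \<in> bounded_wipf (Suc n) b \<longleftrightarrow>
      \<alpha> \<in> weakly_increasing_parking_functions (Suc n) \<and> \<alpha> ! n \<le> b" for \<alpha> b
  proof (cases \<alpha> rule: rev_cases)
    case Nil
    then show ?thesis by (simp add: bounded_wipf_def wipf_iff)
  next
    case (snoc \<beta> y)
    have "length \<beta> = n \<and> sorted (\<beta> @ [y])" if "\<alpha> \<in> weakly_increasing_parking_functions (Suc n)"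
      using that snoc by (simp add: wipf_iff)
    then show ?thesis
      using snoc by (auto simp: bounded_wipf_def sorted_append nth_append) (meson order_trans)
  qed
  have "bounded_wipf (Suc n) (Suc k) = bounded_wipf (Suc n) k \<union> ?L"
    by (auto simp: bounded_iff)
  moreover have "bounded_wipf (Suc n) k \<inter> ?L = {}"
    by (auto simp: bounded_iff)
  ultimately have "card (bounded_wipf (Suc n) (Suc k)) = card (bounded_wipf (Suc n) k) + card ?L"
    by (simp add: card_Un_disjoint finite_weakly_increasing_parking_functions)
  also have "card ?L = card (bounded_wipf n (Suc k))"
    using assms by (intro card_wipf_last_eq) auto
  finally show ?thesis .
qed

text \<open>
  These are the ballot numbers; multiplying by \<open>n + 1\<close> avoids a division.  Beyond \<open>k = n\<close> the
  formula fails: at \<open>k = n + 1\<close> the right-hand side vanishes, while the count stays constant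
  once the bound reaches \<open>n\<close>.  In the induction, the recurrence is missing for exactly one
  step, the one that raises the bound from \<open>n + 1\<close> to \<open>n + 2\<close> at length \<open>n + 1\<close>.  There the count
  does not grow, and the vanishing right-hand side is the correct increment, so that
  the same computation covers this step too.
\<close>
lemma card_bounded_wipf:
  assumes "k \<le> n"
  shows "(real n + 1) * real (card (bounded_wipf n (Suc k)))
           = (real n + 1 - real k) * real ((n + k) choose k)"
  using assms
proof (induction n arbitrary: k)
  case 0
  then show ?case by (simp add: bounded_wipf_0_left)
next
  case (Suc n)
  note IH_n = Suc.IH
  from Suc.prems show ?case
  proof (induction k)
    case 0
    have "real (card (bounded_wipf n (Suc 0))) = 1"
      using IH_n[of 0] by simp
    then show ?case
      by (simp add: card_bounded_wipf_Suc bounded_wipf_0_right)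
  next
    case (Suc k)
    define B where "B = real ((Suc n + k) choose k)"
    have row: "(real n + 2) * real (card (bounded_wipf (Suc n) (Suc k))) = (real n + 2 - real k) * B"
      using Suc by (simp add: B_def algebra_simps)
    have up: "(real k + 1) * real ((Suc n + Suc k) choose Suc k) = (real n + real k + 2) * B"
      using arg_cong[OF Suc_times_binomial[of k "Suc n + k"], of real]
      by (simp add: B_def algebra_simps del: binomial_Suc_Suc)
    have right: "(real k + 1) * real ((n + Suc k) choose Suc k) = (real n + 1) * B"
    proof -
      have "real ((Suc n + Suc k) choose Suc k) = B + real ((n + Suc k) choose Suc k)"
        by (simp add: B_def)
      with up show ?thesis by (simp add: algebra_simps)
    qed
    \<comment> \<open>The increment \<open>G\<close> is given by the shorter lists, or is zero when \<open>k = n\<close>.\<close>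
    define G where "G = real (card (bounded_wipf (Suc n) (Suc (Suc k))))
                          - real (card (bounded_wipf (Suc n) (Suc k)))"
    have "(real n + 1) * G = (real n - real k) * real ((n + Suc k) choose Suc k)"
    proof (cases "Suc k \<le> n")
      case True
      then show ?thesis
        using IH_n[of "Suc k"] by (simp add: G_def card_bounded_wipf_Suc)
    next
      case False
      with Suc.prems have "k = n" by simp
      then have "G = 0"
        by (simp add: G_def wipf_eq_bounded_wipf[symmetric])
      with \<open>k = n\<close> show ?thesis by simp
    qed
    then have "(real n + 1) * ((real k + 1) * G) = (real n + 1) * ((real n - real k) * B)"
      using right by (metis mult.left_commute)
    then have gain: "(real k + 1) * G = (real n - real k) * B"
      by (subst (asm) mult_cancel_left) linarith
    have "(real k + 1) * ((real n + 2) * real (card (bounded_wipf (Suc n) (Suc (Suc k)))))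
        = (real k + 1) * ((real n + 2) * real (card (bounded_wipf (Suc n) (Suc k))))
          + (real n + 2) * ((real k + 1) * G)"
      by (simp add: G_def algebra_simps)
    also have "\<dots> = (real k + 1) * ((real n + 2 - real k) * B) + (real n + 2) * ((real n - real k) * B)"
      by (simp only: row gain)
    also have "\<dots> = (real n + 1 - real k) * ((real n + real k + 2) * B)"
      by (simp add: algebra_simps)
    also have "\<dots> = (real k + 1) * ((real n + 1 - real k) * real ((Suc n + Suc k) choose Suc k))"
      by (simp only: up[symmetric] mult.left_commute)
    finally have "(real n + 2) * real (card (bounded_wipf (Suc n) (Suc (Suc k))))
        = (real n + 1 - real k) * real ((Suc n + Suc k) choose Suc k)"
      by (subst (asm) mult_cancel_left) linarith
    then show ?case by (simp add: add.commute del: binomial_Suc_Suc)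
  qed
qed

text \<open>
  The binomial coefficient \<open>(n - 1 + k) choose k\<close> is written with a rising factorial, which for
  fixed \<open>k\<close> is a product of a fixed number of factors close to \<open>n\<close>.  The two divisions come from
  the ballot numbers for lengths \<open>n - 1\<close> and \<open>n\<close>.
\<close>
lemma prob_wipf_last:
  assumes "k < n"
  shows "measure_pmf.prob (pmf_of_set (weakly_increasing_parking_functions n)) {\<alpha>. \<alpha> ! (n - 1) = Suc k}
           = (real n - real k) * (pochhammer (real n) k / fact k) * (real n + 1)
               / (real n * real ((2 * n) choose n))"
proof -
  obtain m where n: "n = Suc m" using assms by (cases n) auto
  let ?W = "weakly_increasing_parking_functions n"
  have "real n * real (card (?W \<inter> {\<alpha>. \<alpha> ! (n - 1) = Suc k})) = (real n - real k) * real ((m + k) choose k)"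
    using card_bounded_wipf[of k m] assms
    by (simp add: n card_wipf_last_eq add.commute)
  also have "real ((m + k) choose k) = pochhammer (real n) k / fact k"
    by (simp add: binomial_gbinomial gbinomial_pochhammer' n add.commute)
  finally have last: "real (card (?W \<inter> {\<alpha>. \<alpha> ! (n - 1) = Suc k}))
      = (real n - real k) * (pochhammer (real n) k / fact k) / real n"
    using assms by (simp add: field_simps)
  have "(real n + 1) * real (card ?W) = real ((2 * n) choose n)"
    using card_bounded_wipf[of n n] by (simp add: wipf_eq_bounded_wipf[of n "Suc n"] mult_2)
  then have total: "real (card ?W) = real ((2 * n) choose n) / (real n + 1)"
    by (simp add: field_simps)
  have "measure_pmf.prob (pmf_of_set ?W) {\<alpha>. \<alpha> ! (n - 1) = Suc k}
      = real (card (?W \<inter> {\<alpha>. \<alpha> ! (n - 1) = Suc k})) / real (card ?W)"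
    by (rule measure_pmf_of_set[OF weakly_increasing_parking_functions_nonempty
          finite_weakly_increasing_parking_functions])
  then show ?thesis
    unfolding last total by simp
qed


section \<open>Asymptotics\<close>

text \<open>
  Up to sign, \<open>((2 n) choose n) / 4 ^ n\<close> is the generalized binomial coefficient
  \<open>(-1/2) gchoose n\<close>, whose growth is known in terms of \<open>Gamma (1/2) = sqrt \<pi>\<close>.
\<close>
lemma central_binomial_limit:
  "(\<lambda>n. 4 ^ n / (real ((2 * n) choose n) * sqrt (pi * real n))) \<longlonglongrightarrow> 1"
proof -
  have gbinom: "(-1/2 :: real) gchoose n = (-1) ^ n * (real ((2 * n) choose n) / 4 ^ n)" for n
  proof -
    have "fact (2 * n) = (4 ^ n * pochhammer (1/2) n * fact n :: real)"
      by (simp add: fact_double power_mult)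
    then show ?thesis
      by (simp add: gbinomial_pochhammer binomial_fact field_simps)
  qed
  have "(\<lambda>n. (-1/2 gchoose n) / ((-1) ^ n / exp ((-1/2 + 1) * of_real (ln (real n)))))
      \<longlonglongrightarrow> inverse (Gamma (- (-1/2 :: real)))"
    by (rule gbinomial_asymptotic)
  then have "(\<lambda>n. (-1/2 gchoose n) / ((-1) ^ n / exp (ln (real n) / 2))) \<longlonglongrightarrow> inverse (sqrt pi)"
    by (simp add: Gamma_one_half_real)
  moreover have "eventually (\<lambda>n. (-1/2 gchoose n) / ((-1) ^ n / exp (ln (real n) / 2))
      = real ((2 * n) choose n) * sqrt (real n) / 4 ^ n) sequentially"
    using eventually_gt_at_top[of 0]
  proof eventually_elim
    case (elim n)
    have "exp (ln (real n) / 2) = sqrt (real n)"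
      using elim by (simp add: powr_half_sqrt[symmetric] powr_def)
    then show ?case unfolding gbinom by simp
  qed
  ultimately have "(\<lambda>n. real ((2 * n) choose n) * sqrt (real n) / 4 ^ n) \<longlonglongrightarrow> inverse (sqrt pi)"
    by (rule Lim_transform_eventually)
  then have "(\<lambda>n. sqrt pi * (real ((2 * n) choose n) * sqrt (real n) / 4 ^ n)) \<longlonglongrightarrow> sqrt pi * inverse (sqrt pi)"
    by (intro tendsto_intros)
  from tendsto_inverse[OF this] show ?thesis
    by (simp add: real_sqrt_mult field_simps)
qed

lemma pochhammer_over_power_limit:
  "(\<lambda>n. pochhammer (real n) k / (real n + c) ^ k) \<longlonglongrightarrow> 1"
proof -
  have "(\<lambda>n. \<Prod>i=0..<k. (real n + real i) / (real n + c)) \<longlonglongrightarrow> (\<Prod>i=0..<k. 1)"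
    by (intro tendsto_prod) real_asymp
  then show ?thesis
    by (simp add: pochhammer_prod prod_dividef)
qed

theorem lemma2p3:
  fixes j :: nat
  assumes "j \<ge> 1"
  shows "(\<lambda>n::nat. measure_pmf.prob (pmf_of_set (weakly_increasing_parking_functions n))
             {\<alpha>. \<alpha> ! (n - 1) = j})
         \<sim>[at_top]
         (\<lambda>n::nat. sqrt (pi * real n) * (real n - real j + 1) * exp (real n + real j - 2) / 4 ^ n *
             measure_pmf.prob (poisson_pmf (real n + real j - 2)) {k. k = j - 1})"
    (is "?f \<sim>[at_top] ?g")
proof (rule asymp_equivI')
  obtain k where j: "j = Suc k" using assms by (cases j) auto
  let ?h = "\<lambda>n. (real n + 1) / real n * (pochhammer (real n) k / (real n + (real k - 1)) ^ k)
              * (4 ^ n / (real ((2 * n) choose n) * sqrt (pi * real n)))"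
  have "(\<lambda>n. (real n + 1) / real n) \<longlonglongrightarrow> 1" by real_asymp
  from tendsto_mult[OF tendsto_mult[OF this pochhammer_over_power_limit] central_binomial_limit]
  have "?h \<longlonglongrightarrow> 1" by simp
  moreover have "eventually (\<lambda>n. ?h n = ?f n / ?g n) at_top"
    \<comment> \<open>For such \<open>n\<close> the Poisson rate is positive, and \<open>j\<close> is a possible last entry.\<close>
    using eventually_gt_at_top[of "Suc k"]
  proof eventually_elim
    case (elim n)
    define r where "r = real n + (real k - 1)"
    define C where "C = real ((2 * n) choose n)"
    have rate: "real n + real j - 2 = r" and r: "r > 0"
      using elim by (auto simp: r_def j)
    have poisson: "measure_pmf.prob (poisson_pmf r) {i. i = j - 1} = r ^ k / fact k * exp (- r)"
      using r by (simp add: measure_pmf_single j)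
    have g: "?g n = sqrt (pi * real n) * (real n - real k) / 4 ^ n * (r ^ k / fact k)"
      unfolding rate poisson by (simp add: j exp_minus field_simps)
    have f: "?f n = (real n - real k) * (pochhammer (real n) k / fact k) * (real n + 1) / (real n * C)"
      using prob_wipf_last[of k n] elim by (simp add: j C_def)
    define D where "D = real n - real k"
    define S where "S = sqrt (pi * real n)"
    have "C > 0" "S > 0" "D > 0" "real n > 0"
      using elim by (auto simp: C_def S_def D_def)
    then show ?case
      unfolding f g unfolding r_def[symmetric] C_def[symmetric] D_def[symmetric] S_def[symmetric]
      using r by (simp add: divide_simps)
  qed
  ultimately show "(\<lambda>n. ?f n / ?g n) \<longlonglongrightarrow> 1"
    by (rule Lim_transform_eventually)
qed

end
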